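(* For all integers $n$ and $k$ with $0 < k < n$, the diameter of the Full-Flag Johnson graph $FJ(n,k)$ is at least $\binom{n}{2}/\binom{k+1}{2}$.
   Context: For a permutation $u=(u_1,\ldots,u_n)$ of $(1,2,\ldots,n)$ and $i \in [n]=\{1,\ldots,n\}$ write $u(i) = \{u_1, u_2, \ldots, u_i\}$. For integers $0 \leq k < n$, the Full-Flag Johnson graph $FJ(n,k)$ has as vertex set all permutations of $(1,\ldots,n)$; two vertices $u,v$ are adjacent if and only if $u(i) \neq v(i)$ for exactly $k$ integers $i \in [n]$. The graph is called non-trivial when $k>0$. *)

theory Defs
  imports
    "HOL-Combinatorics.Permutations"
    "Graph_Theory.Pair_Digraph"
    "Graph_Theory.Shortest_Path"
begin

definition prefix_set :: "(nat \<Rightarrow> nat) \<Rightarrow> nat \<Rightarrow> nat set" where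
  "prefix_set u i = u ` {1..i}"

text \<open>
  A permutation \<open>(u\<^sub>1, \<dots>, u\<^sub>n)\<close> is the function \<open>u\<close> permuting \<open>{1..n}\<close> with \<open>u i = u\<^sub>i\<close>, and
  an undirected edge is a pair of opposite arcs. For \<open>k = 0\<close> the relation below degenerates to loops.
\<close>

definition FJ :: "nat \<Rightarrow> nat \<Rightarrow> (nat \<Rightarrow> nat) pair_pre_digraph" where
  "FJ n k = \<lparr>
     pverts = {u. u permutes {1..n}},
     parcs = {(u, v). u permutes {1..n} \<and> v permutes {1..n} \<and>
                card {i \<in> {1..n}. prefix_set u i \<noteq> prefix_set v i} = k} \<rparr>"

lemma pair_graph_FJ:
  assumes "0 < k"
  shows "pair_graph (FJ n k)"
proof
  show "finite (pverts (FJ n k))"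
    by (simp add: FJ_def finite_permutations)
  have "parcs (FJ n k) \<subseteq> pverts (FJ n k) \<times> pverts (FJ n k)"
    by (auto simp: FJ_def)
  then show "finite (parcs (FJ n k))"
    by (rule finite_subset) (intro finite_cartesian_product \<open>finite (pverts (FJ n k))\<close>)
  show "symmetric (FJ n k)"
    unfolding symmetric_def with_proj_simps
  proof (rule symI)
    fix u v
    have "{i \<in> {1..n}. prefix_set u i \<noteq> prefix_set v i} = {i \<in> {1..n}. prefix_set v i \<noteq> prefix_set u i}"
      by blast
    then show "(v, u) \<in> parcs (FJ n k)" if "(u, v) \<in> parcs (FJ n k)"
      using that by (simp add: FJ_def del: atLeastAtMost_iff)
  qed
qed (use assms in \<open>auto simp: FJ_def\<close>)

text \<open>
  The library's shortest-path function with unit arc weights is the graph distance; it is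
  \<open>\<infinity>\<close> between vertices that no walk connects.
\<close>

definition graph_diameter :: "('a, 'b) pre_digraph \<Rightarrow> ereal" where
  "graph_diameter G = (SUP u\<in>verts G. SUP v\<in>verts G. wf_digraph.\<mu> G (\<lambda>_. 1) u v)"

end

theory Submission
  imports Defs
begin

text \<open>
  The number of value pairs that two permutations order differently is a pseudometric on
  permutations. If \<open>x\<close> sits at position \<open>p\<close> and \<open>y\<close> at position \<open>q > p\<close> in \<open>u\<close>, but \<open>y\<close> precedes
  \<open>x\<close> in \<open>v\<close>, then every prefix of length \<open>i\<close> with \<open>p \<le> i < q\<close> contains \<open>x\<close> and not \<open>y\<close> in \<open>u\<close>, so
  \<open>u\<close> and \<open>v\<close> differ at each such \<open>i\<close>. Sending the pair to \<open>(p, q - 1)\<close> thus embeds the discordant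
  pairs of two adjacent vertices into the weakly increasing pairs of a \<open>k\<close>-element set, and one step
  changes at most \<open>(k + 1) choose 2\<close> of them. Reversing the identity has to change all \<open>n choose 2\<close>.
\<close>

lemma card_less_pairs:
  fixes A :: "'a::linorder set"
  assumes "finite A"
  shows "card {(x, y). x \<in> A \<and> y \<in> A \<and> x < y} = card A choose 2"
  using assms
proof (induction A rule: finite_linorder_max_induct)
  case empty
  then show ?case by simp
next
  case (insert b A)
  have eq: "{(x, y). x \<in> insert b A \<and> y \<in> insert b A \<and> x < y}
      = {(x, y). x \<in> A \<and> y \<in> A \<and> x < y} \<union> (\<lambda>x. (x, b)) ` A"
    using insert.hyps by auto
  have "finite {(x, y). x \<in> A \<and> y \<in> A \<and> x < y}"
    by (rule finite_subset[of _ "A \<times> A"]) (use insert.hyps in auto)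
  moreover have "b \<notin> A"
    using insert.hyps by auto
  ultimately have "card {(x, y). x \<in> insert b A \<and> y \<in> insert b A \<and> x < y}
      = (card A choose 2) + card A"
    unfolding eq using insert.hyps insert.IH
    by (subst card_Un_disjoint) (auto simp: card_image inj_on_def)
  then show ?case
    using insert.hyps \<open>b \<notin> A\<close> by (simp add: numeral_2_eq_2)
qed

text \<open>The diagonal adds \<open>card A\<close> pairs to the strict ones, and Pascal's rule
  merges the two counts.\<close>

lemma card_le_pairs:
  fixes A :: "'a::linorder set"
  assumes "finite A"
  shows "card {(x, y). x \<in> A \<and> y \<in> A \<and> x \<le> y} = (card A + 1) choose 2"
proof -
  have eq: "{(x, y). x \<in> A \<and> y \<in> A \<and> x \<le> y} = {(x, y). x \<in> A \<and> y \<in> A \<and> x < y} \<union> Id_on A"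
    by (auto simp: Id_on_iff order_le_less)
  have "finite {(x, y). x \<in> A \<and> y \<in> A \<and> x < y}"
    by (rule finite_subset[of _ "A \<times> A"]) (use assms in auto)
  moreover have "Id_on A = (\<lambda>x. (x, x)) ` A"
    by auto
  ultimately show ?thesis
    unfolding eq using assms card_less_pairs[OF assms]
    by (subst card_Un_disjoint) (auto simp: card_image inj_on_def numeral_2_eq_2)
qed

text \<open>\<open>inv u x\<close> is the position of the value \<open>x\<close> in
  \<open>u\<close>. Listing each pair in its \<open>u\<close>-order counts every inversion between
  \<open>u\<close> and \<open>v\<close> once.\<close>

definition discordant :: "nat \<Rightarrow> (nat \<Rightarrow> nat) \<Rightarrow> (nat \<Rightarrow> nat) \<Rightarrow> (nat \<times> nat) set" where
  "discordant n u v =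
    {(x, y). x \<in> {1..n} \<and> y \<in> {1..n} \<and> inv u x < inv u y \<and> inv v y < inv v x}"

lemma finite_discordant: "finite (discordant n u v)"
  by (rule finite_subset[of _ "{1..n} \<times> {1..n}"]) (auto simp: discordant_def)

lemma discordant_refl: "discordant n u u = {}"
  by (auto simp: discordant_def)

text \<open>If \<open>u\<close> and \<open>w\<close> disagree on a pair, then \<open>v\<close>
  disagrees with one of them on it. Injectivity of \<open>inv v\<close> rules out a tie.\<close>

lemma discordant_triangle:
  assumes "v permutes {1..n}"
  shows "card (discordant n u w) \<le> card (discordant n u v) + card (discordant n v w)"
proof -
  have "inj (inv v)"
    using permutes_inj[OF permutes_inv[OF assms]] .
  have "discordant n u w \<subseteq> discordant n u v \<union> discordant n v w"
  proof (rule subrelI)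
    fix x y assume xy: "(x, y) \<in> discordant n u w"
    then have "x \<noteq> y"
      by (auto simp: discordant_def)
    then have "inv v x \<noteq> inv v y"
      using \<open>inj (inv v)\<close> by (simp add: inj_eq)
    then show "(x, y) \<in> discordant n u v \<union> discordant n v w"
      using xy by (auto simp: discordant_def)
  qed
  then have "card (discordant n u w) \<le> card (discordant n u v \<union> discordant n v w)"
    by (intro card_mono) (simp_all add: finite_discordant)
  also have "\<dots> \<le> card (discordant n u v) + card (discordant n v w)"
    by (rule card_Un_le)
  finally show ?thesis .
qed

lemma mem_prefix_set_iff:
  assumes "u permutes {1..n}" and "x \<in> {1..n}"
  shows "x \<in> prefix_set u i \<longleftrightarrow> inv u x \<le> i"
proof -
  have "inv u x \<in> {1..n}"
    using assms by (metis permutes_in_image permutes_inv)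
  then show ?thesis
    unfolding prefix_set_def using permutes_inverses[OF assms(1)]
    by (auto simp: image_iff intro!: bexI[of _ "inv u x"])
qed

lemma card_discordant_le:
  assumes u: "u permutes {1..n}" and v: "v permutes {1..n}"
  shows "card (discordant n u v)
    \<le> (card {i \<in> {1..n}. prefix_set u i \<noteq> prefix_set v i} + 1) choose 2"
proof -
  let ?D = "{i \<in> {1..n}. prefix_set u i \<noteq> prefix_set v i}"
  let ?f = "\<lambda>(x, y). (inv u x, inv u y - 1)"
  have differ: "i \<in> ?D"
    if "(x, y) \<in> discordant n u v" "inv u x \<le> i" "i < inv u y" for x y i
  proof -
    have xy: "x \<in> {1..n}" "y \<in> {1..n}" "inv v y < inv v x"
      using that by (auto simp: discordant_def)
    have "inv u x \<in> {1..n}" "inv u y \<in> {1..n}"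
      using xy u by (metis permutes_in_image permutes_inv)+
    then have "i \<in> {1..n}"
      using that by auto
    moreover have "x \<in> prefix_set u i" "y \<notin> prefix_set u i"
      using xy that by (simp_all add: mem_prefix_set_iff[OF u])
    \<comment> \<open>In \<open>v\<close> the value \<open>y\<close> comes first, so no prefix of
      \<open>v\<close> can separate \<open>x\<close> from \<open>y\<close> the way the prefix of
      \<open>u\<close> does.\<close>
    moreover have "x \<in> prefix_set v i \<Longrightarrow> y \<in> prefix_set v i"
      using xy by (simp add: mem_prefix_set_iff[OF v])
    ultimately show ?thesis
      by auto
  qed
  have "inj (inv u)"
    using permutes_inj[OF permutes_inv[OF u]] .
  have "inj_on ?f (discordant n u v)"
  proof (rule inj_onI, clarify)
    fix x y x' y'
    assume "(x, y) \<in> discordant n u v" "(x', y') \<in> discordant n u v"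
      and "inv u x = inv u x'" "inv u y - 1 = inv u y' - 1"
    \<comment> \<open>Discordance makes \<open>inv u y\<close> exceed \<open>inv u x\<close>, so it
      is positive and the truncated subtraction loses nothing.\<close>
    then have "inv u x = inv u x'" "inv u y = inv u y'"
      unfolding discordant_def by auto
    then show "x = x' \<and> y = y'"
      using \<open>inj (inv u)\<close> by (simp add: inj_eq)
  qed
  moreover have "?f ` discordant n u v \<subseteq> {(p, q). p \<in> ?D \<and> q \<in> ?D \<and> p \<le> q}"
  proof
    fix z assume "z \<in> ?f ` discordant n u v"
    then obtain x y where xy: "(x, y) \<in> discordant n u v" and z: "z = (inv u x, inv u y - 1)"
      by auto
    have "inv u x < inv u y"
      using xy by (simp add: discordant_def)
    then have le: "inv u x \<le> inv u y - 1" "inv u y - 1 < inv u y"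
      by auto
    \<comment> \<open>These are the two ends of the interval covered by \<open>differ\<close>; they
      coincide when \<open>x\<close> and \<open>y\<close> are neighbours in \<open>u\<close>, hence
      weak pairs.\<close>
    have "inv u x \<in> ?D" "inv u y - 1 \<in> ?D"
      using differ[OF xy order_refl] differ[OF xy le] \<open>inv u x < inv u y\<close> by blast+
    then show "z \<in> {(p, q). p \<in> ?D \<and> q \<in> ?D \<and> p \<le> q}"
      using z le by simp
  qed
  moreover have "finite {(p, q). p \<in> ?D \<and> q \<in> ?D \<and> p \<le> q}"
    by (rule finite_subset[of _ "?D \<times> ?D"]) auto
  ultimately have "card (discordant n u v) \<le> card {(p, q). p \<in> ?D \<and> q \<in> ?D \<and> p \<le> q}"
    by (rule card_inj_on_le)
  then show ?thesis
    using card_le_pairs[of ?D] by simp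
qed

text \<open>The triangle inequality accumulates the bound for a single arc along the walk.\<close>

lemma card_discordant_awalk_le:
  assumes "wf_digraph (with_proj (FJ n k))"
    and "pre_digraph.awalk (with_proj (FJ n k)) u p v"
  shows "card (discordant n u v) \<le> length p * ((k + 1) choose 2)"
  using assms(2)
proof (induction p arbitrary: u)
  case Nil
  then show ?case
    by (simp add: wf_digraph.awalk_Nil_iff[OF assms(1)] discordant_refl)
next
  case (Cons e p)
  obtain w where e: "e = (u, w)" and arc: "(u, w) \<in> parcs (FJ n k)"
    and walk: "pre_digraph.awalk (with_proj (FJ n k)) w p v"
    using Cons.prems by (cases e) (auto simp: wf_digraph.awalk_Cons_iff[OF assms(1)])
  have perm: "u permutes {1..n}" "w permutes {1..n}"
    and "card {i \<in> {1..n}. prefix_set u i \<noteq> prefix_set w i} = k"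
    using arc unfolding FJ_def by auto
  then have "card (discordant n u w) \<le> (k + 1) choose 2"
    using card_discordant_le[of u n w] by simp
  with Cons.IH[OF walk] discordant_triangle[OF perm(2), of u v] show ?case
    by simp
qed

theorem theorem4p4:
  fixes n k :: nat
  assumes "0 < k" and "k < n"
  shows "ereal (real (n choose 2) / real ((k + 1) choose 2)) \<le> graph_diameter (with_proj (FJ n k))"
proof -
  interpret pair_graph "FJ n k"
    by (rule pair_graph_FJ) (rule assms)
  have wf: "wf_digraph (with_proj (FJ n k))"
    by unfold_locales
  \<comment> \<open>The reversal of \<open>{1..n}\<close>, fixing everything outside; being an
    involution, it is its own inverse.\<close>
  define r where "r i = (if i \<in> {1..n} then n + 1 - i else i)" for i
  have invol: "r (r i) = i" for i
    by (auto simp: r_def)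
  have "bij_betw r {1..n} {1..n}"
    by (rule bij_betw_byWitness[where f' = r]) (auto simp: invol, auto simp: r_def)
  then have r: "r permutes {1..n}"
    by (rule bij_imp_permutes) (auto simp: r_def)
  have "inv r = r"
    by (rule inv_unique_comp) (auto simp: invol)
  then have "discordant n id r = {(x, y). x \<in> {1..n} \<and> y \<in> {1..n} \<and> x < y}"
    by (auto simp: discordant_def r_def)
  then have card: "card (discordant n id r) = n choose 2"
    using card_less_pairs[of "{1..n}"] by simp
  have "ereal (real (n choose 2) / real ((k + 1) choose 2)) \<le> \<mu> (\<lambda>_. 1) id r"
    unfolding \<mu>_def
  \<comment> \<open>The distance is an infimum over walks, so a bound for each walk suffices; with
    no walk it is infinite and the bound holds trivially.\<close>
  proof (rule INF_greatest)
    fix p assume "p \<in> {p. awalk id p r}"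
    then have "n choose 2 \<le> length p * ((k + 1) choose 2)"
      using card_discordant_awalk_le[OF wf, of id p r] card by simp
    then have "real (n choose 2) \<le> real (length p) * real ((k + 1) choose 2)"
      by (metis of_nat_le_iff of_nat_mult)
    moreover have "0 < (k + 1) choose 2"
      using assms by (intro zero_less_binomial) simp
    ultimately show "ereal (real (n choose 2) / real ((k + 1) choose 2)) \<le> ereal (awalk_cost (\<lambda>_. 1) p)"
      by (simp add: awalk_cost_def sum_list_triv pos_divide_le_eq)
  qed
  also have "\<dots> \<le> graph_diameter (with_proj (FJ n k))"
    unfolding graph_diameter_def using r permutes_id[of "{1..n}"]
    by (intro SUP_upper2[of id] SUP_upper2[of r]) (auto simp: FJ_def)
  finally show ?thesis .
qed

end
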